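(* The Shapley group value $\phi^g$ satisfies all of the following properties, where each property is stated for a group value $\xi^g$ (and is asserted for $\xi^g=\phi^g$): \begin{itemize} \item[(P1)] ($G$-coherence) $\sum_{i\in N}\xi^g(\{i\};N,v)=\xi^g(N;N,v)$ for all $N\in\mathcal N$ and $v\in\mathcal G_N$. \item[(P2)] ($G$-dummy player) For all $N\in\mathcal N$, $C\subsetneq N$, $i\in N\setminus C$ and $v\in\mathcal G_N$: if $i$ is a dummy player in $v$, then $\xi^g(C\cup\{i\};N,v)=\xi^g(C;N,v)+v(\{i\})$. \item[(P3)] ($G$-null player) For all $N\in\mathcal N$, $C\subsetneq N$, $i\in N\setminus C$ and $v\in\mathcal G_N$: if $i$ is a null player in $v$, then $\xi^g(C\cup\{i\};N,v)=\xi^g(C;N,v)$. \item[(P4)] ($G$-anonymity) For all $N\in\mathcal N$, $C\subset N$, $v\in\mathcal G_N$ and all permutations $\pi$ of $N$: $\xi^g(\pi(C);\pi(N),\pi v)=\xi^g(C;N,v)$, where $\pi v$ is given by $\pi v(\pi(S)):=v(S)$ for $S\subset N$ and $\pi(S)=\{\pi(i): i\in S\}$. \item[(P5)] ($G$-linearity) $\xi^g(C;N,\alpha_1v+\alpha_2w)=\alpha_1\xi^g(C;N,v)+\alpha_2\xi^g(C;N,w)$ for all $N\in\mathcal N$, $C\subset N$, $\alpha_1,\alpha_2\in\mathbb R$ and $v,w\in\mathcal G_N$, where $(\alpha_1v+\alpha_2w)(S)=\alpha_1v(S)+\alpha_2w(S)$ for all $S\subset N$. \item[(P6)] ($G$-coalitional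 balanced contributions) For all $N\in\mathcal N$, $C\subsetneq N$, distinct $i,j\in N\setminus C$ and $v\in\mathcal G_N$, \begin{multline*} \bigl(\xi^g(C\cup\{i\};N,v)-\xi^g(C;N,v)\bigr)-\bigl(\xi^g(C\cup\{i\};N\setminus\{j\},v_{-j})-\xi^g(C;N\setminus\{j\},v_{-j})\bigr)\\ =\bigl(\xi^g(C\cup\{j\};N,v)-\xi^g(C;N,v)\bigr)-\bigl(\xi^g(C\cup\{j\};N\setminus\{i\},v_{-i})-\xi^g(C;N\setminus\{i\},v_{-i})\bigr), \end{multline*} where $v_{-i}\in\mathcal G_{N\setminus\{i\}}$ denotes the restriction of $v$ to the subsets of $N\setminus\{i\}$. \item[(P7)] ($G$-symmetry over pure bargaining games) $\xi^g(C;N,u_N)=\frac{1}{n-c+1}$ for all $N\in\mathcal N$ and non-empty $C\subset N$, where $n=|N|$, $c=|C|$ and $u_N$ is the unanimity game with respect to $N$. \item[(P8)] ($G$-coalitional monotonicity) For all $N\in\mathcal N$, $C\subset T\subset N$ and $v,w\in\mathcal G_N$ such that $v(S)=w(S)$ for all $S\neq T$ and $v(T)<w(T)$: $\xi^g(C;N,v)\le\xi^g(C;N,w)$. \item[(P9)] ($G$-strong monotonicity) For all $N\in\mathcal N$, $C\subset N$ and $v,w\in\mathcal G_N$ such that $v(S\cup C)-v(S)\le w(S\cup C)-w(S)$ for all $S\subset N\setminus C$: $\xi^g(C;N,v)\le\xi^g(C;N,w)$. \item[(P10)] ($G$-positivity) $\xi^g(C;N,v)\ge 0$ for all $N\in\mathcal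 N$, $C\subset N$ and every monotonic $v\in\mathcal G_N$. \item[(P11)] ($G$-relative invariance with respect to strategic equivalence) For all $N\in\mathcal N$, $C\subset N$, $v\in\mathcal G_N$, $a>0$ and $b=(b_i)_{i\in N}\in\mathbb R^N$: $\xi^g(C;N,w)=a\,\xi^g(C;N,v)+\sum_{i\in C}b_i$, where $w\in\mathcal G_N$ is given by $w(S)=a\,v(S)+\sum_{i\in S}b_i$ for all $S\subset N$. \item[(P12)] ($G$-coalitional strategic equivalence) $\xi^g(C;N,v)=\xi^g(C;N,v+\lambda u_T)$ for all $N\in\mathcal N$, $C\subsetneq N$, $\emptyset\neq T\subset N\setminus C$, $\lambda\in\mathbb R$ and $v\in\mathcal G_N$. \item[(P13)] ($G$-fair ranking) For all $N\in\mathcal N$, $T\subset N$ and $v,w\in\mathcal G_N$ such that $v(S)=w(S)$ for all $S\neq T$: for all $C_1,C_2\subset T$ with $|C_1|=|C_2|$, $\xi^g(C_1;N,v)>\xi^g(C_2;N,v)$ implies $\xi^g(C_1;N,w)>\xi^g(C_2;N,w)$. \end{itemize}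
   Context: Let $\mathcal U=\{1,2,\dots\}$ and let $\mathcal N$ be the class of all non-empty finite subsets of $\mathcal U$. The symbol $\subset$ allows equality. For a finite set $N$, a game (characteristic function) on $N$ is a function $v:2^N\to\mathbb R$ with $v(\emptyset)=0$; $\mathcal G_N$ is the set of all games on $N$, and $\mathcal G=\bigcup_{N\in\mathcal N}\mathcal G_N$. Cardinalities of $N,S,C$ are denoted $n,s,c$. For $v\in\mathcal G_N$, the Shapley value of player $i\in N$ is $$\phi_i(N,v)=\sum_{S\subset N\setminus\{i\}}\frac{s!(n-s-1)!}{n!}\bigl(v(S\cup\{i\})-v(S)\bigr).$$ For non-empty $C\subset N$, the merging game $(N_C,v_C)$ has player set $N_C=(N\setminus C)\cup\{\mathbf c\}$, where $\mathbf c$ is a single new proxy player replacing $C$ (so $|N_C|=n-c+1$), and for $S\subset N_C$: $v_C(S)=v(S)$ if $\mathbf c\notin S$, and $v_C(S)=v((S\setminus\{\mathbf c\})\cup C)$ if $\mathbf c\in S$. A group value $\xi^g$ is a mapping assigning to every $N\in\mathcal N$, $v\in\mathcal G_N$ and $C\subset N$ a real number $\xi^g(C;N,v)$, with $\xi^g(\emptyset;N,v)=0$. The Shapley group value is the group value $\phi^g$ given by $\phi^g(C;N,v)=\phi_{\mathbf c}(N_C,v_C)$ for non-empty $C\subset N$ (and $\phi^g(\emptyset;N,v)=0$). For non-empty $S\subset N$, the unanimity game $u_S\in\mathcal G_N$ is given by $u_S(T)=1$ if $S\subset T$ and $u_S(T)=0$ otherwise. Player $i\in N$ is a dummy player in $v\in\mathcal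 G_N$ if $v(S\cup\{i\})=v(S)+v(\{i\})$ for all $S\subset N\setminus\{i\}$; a dummy player with $v(\{i\})=0$ is a null player. A game $v\in\mathcal G_N$ is monotonic if $v(T)\ge v(S)$ for all $S\subset T\subset N$. *)

theory Defs
  imports Complex_Main "HOL-Library.FuncSet" "HOL-Combinatorics.Permutations"
begin

section \<open>Games\<close>

definition player_sets :: "nat set set" where
  "player_sets = {N. finite N \<and> N \<noteq> {} \<and> N \<subseteq> {1..}}"

text \<open>
  A game on \<open>N\<close> is a function whose domain is exactly \<open>Pow N\<close>. Such functions are represented by
  extensional ones, so two games on \<open>N\<close> are equal iff they agree on all coalitions in \<open>N\<close>.
  The definition is polymorphic because a merging game has a player that is not a natural number.
\<close>
definition games :: "'a set \<Rightarrow> ('a set \<Rightarrow> real) set" where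
  "games N = {v \<in> extensional (Pow N). v {} = 0}"

definition subgame :: "'a set \<Rightarrow> ('a set \<Rightarrow> real) \<Rightarrow> 'a set \<Rightarrow> real" where
  "subgame M v = restrict v (Pow M)"

definition unanimity_game :: "'a set \<Rightarrow> 'a set \<Rightarrow> 'a set \<Rightarrow> real" where
  "unanimity_game N S = (\<lambda>T\<in>Pow N. if S \<subseteq> T then 1 else 0)"

text \<open>For a permutation \<open>\<pi>\<close> of \<open>N\<close>, this is the game characterised by
  \<open>permuted_game_apply\<close> below.\<close>
definition permuted_game :: "('a \<Rightarrow> 'a) \<Rightarrow> 'a set \<Rightarrow> ('a set \<Rightarrow> real) \<Rightarrow> 'a set \<Rightarrow> real" where
  "permuted_game \<pi> N v = (\<lambda>S\<in>Pow (\<pi> ` N). v (inv \<pi> ` S))"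

definition dummy_player :: "'a set \<Rightarrow> ('a set \<Rightarrow> real) \<Rightarrow> 'a \<Rightarrow> bool" where
  "dummy_player N v i \<longleftrightarrow> i \<in> N \<and> (\<forall>S. S \<subseteq> N - {i} \<longrightarrow> v (S \<union> {i}) = v S + v {i})"

definition null_player :: "'a set \<Rightarrow> ('a set \<Rightarrow> real) \<Rightarrow> 'a \<Rightarrow> bool" where
  "null_player N v i \<longleftrightarrow> dummy_player N v i \<and> v {i} = 0"

definition monotonic :: "'a set \<Rightarrow> ('a set \<Rightarrow> real) \<Rightarrow> bool" where
  "monotonic N v \<longleftrightarrow> (\<forall>S T. S \<subseteq> T \<and> T \<subseteq> N \<longrightarrow> v T \<ge> v S)"

definition shapley :: "'a set \<Rightarrow> ('a set \<Rightarrow> real) \<Rightarrow> 'a \<Rightarrow> real" where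
  "shapley N v i =
    (\<Sum>S\<in>Pow (N - {i}). fact (card S) * fact (card N - card S - 1) / fact (card N)
        * (v (S \<union> {i}) - v S))"

section \<open>Merging games\<close>

text \<open>
  The players of a merging game have type \<open>'a option\<close>: \<open>None\<close> is the proxy player, which is
  therefore new whatever \<open>N\<close> is, and \<open>Some i\<close> is the remaining player \<open>i \<in> N - C\<close>. For a coalition
  \<open>S\<close> of merged players, \<open>Some -` S\<close> is the set of its members other than the proxy.
\<close>
definition merged_players :: "'a set \<Rightarrow> 'a set \<Rightarrow> 'a option set" where
  "merged_players N C = Some ` (N - C) \<union> {None}"

definition merging_game ::
    "'a set \<Rightarrow> ('a set \<Rightarrow> real) \<Rightarrow> 'a set \<Rightarrow> 'a option set \<Rightarrow> real" where
  "merging_game N v C =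
    (\<lambda>S\<in>Pow (merged_players N C). if None \<in> S then v (Some -` S \<union> C) else v (Some -` S))"

section \<open>Group values and their properties\<close>

text \<open>A group value takes its arguments in the order \<open>C\<close>, \<open>N\<close>, \<open>v\<close>. Only its values at
  \<open>N \<in> player_sets\<close>, \<open>v \<in> games N\<close> and \<open>C \<subseteq> N\<close> are meaningful.\<close>
type_synonym group_val = "nat set \<Rightarrow> nat set \<Rightarrow> (nat set \<Rightarrow> real) \<Rightarrow> real"

definition group_value :: "group_val \<Rightarrow> bool" where
  "group_value \<xi> \<longleftrightarrow> (\<forall>N\<in>player_sets. \<forall>v\<in>games N. \<xi> {} N v = 0)"

definition shapley_group_value :: group_val where
  "shapley_group_value C N v =
    (if C = {} then 0 else shapley (merged_players N C) (merging_game N v C) None)"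

definition G_coherence :: "group_val \<Rightarrow> bool" where
  "G_coherence \<xi> \<longleftrightarrow>
    (\<forall>N\<in>player_sets. \<forall>v\<in>games N. (\<Sum>i\<in>N. \<xi> {i} N v) = \<xi> N N v)"

definition G_dummy_player :: "group_val \<Rightarrow> bool" where
  "G_dummy_player \<xi> \<longleftrightarrow>
    (\<forall>N\<in>player_sets. \<forall>C. C \<subset> N \<longrightarrow> (\<forall>i\<in>N - C. \<forall>v\<in>games N.
      dummy_player N v i \<longrightarrow> \<xi> (C \<union> {i}) N v = \<xi> C N v + v {i}))"

definition G_null_player :: "group_val \<Rightarrow> bool" where
  "G_null_player \<xi> \<longleftrightarrow>
    (\<forall>N\<in>player_sets. \<forall>C. C \<subset> N \<longrightarrow> (\<forall>i\<in>N - C. \<forall>v\<in>games N.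
      null_player N v i \<longrightarrow> \<xi> (C \<union> {i}) N v = \<xi> C N v))"

definition G_anonymity :: "group_val \<Rightarrow> bool" where
  "G_anonymity \<xi> \<longleftrightarrow>
    (\<forall>N\<in>player_sets. \<forall>C. C \<subseteq> N \<longrightarrow> (\<forall>v\<in>games N. \<forall>\<pi>. \<pi> permutes N \<longrightarrow>
      \<xi> (\<pi> ` C) (\<pi> ` N) (permuted_game \<pi> N v) = \<xi> C N v))"

definition G_linearity :: "group_val \<Rightarrow> bool" where
  "G_linearity \<xi> \<longleftrightarrow>
    (\<forall>N\<in>player_sets. \<forall>C. C \<subseteq> N \<longrightarrow> (\<forall>a1 a2. \<forall>v\<in>games N. \<forall>w\<in>games N.
      \<xi> C N (\<lambda>S\<in>Pow N. a1 * v S + a2 * w S) = a1 * \<xi> C N v + a2 * \<xi> C N w))"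

definition G_coalitional_balanced_contributions :: "group_val \<Rightarrow> bool" where
  "G_coalitional_balanced_contributions \<xi> \<longleftrightarrow>
    (\<forall>N\<in>player_sets. \<forall>C. C \<subset> N \<longrightarrow> (\<forall>i\<in>N - C. \<forall>j\<in>N - C. i \<noteq> j \<longrightarrow> (\<forall>v\<in>games N.
      (\<xi> (C \<union> {i}) N v - \<xi> C N v)
        - (\<xi> (C \<union> {i}) (N - {j}) (subgame (N - {j}) v) - \<xi> C (N - {j}) (subgame (N - {j}) v))
      = (\<xi> (C \<union> {j}) N v - \<xi> C N v)
        - (\<xi> (C \<union> {j}) (N - {i}) (subgame (N - {i}) v) - \<xi> C (N - {i}) (subgame (N - {i}) v)))))"

definition G_symmetry_pure_bargaining :: "group_val \<Rightarrow> bool" where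
  "G_symmetry_pure_bargaining \<xi> \<longleftrightarrow>
    (\<forall>N\<in>player_sets. \<forall>C. C \<noteq> {} \<and> C \<subseteq> N \<longrightarrow>
      \<xi> C N (unanimity_game N N) = 1 / (real (card N) - real (card C) + 1))"

definition G_coalitional_monotonicity :: "group_val \<Rightarrow> bool" where
  "G_coalitional_monotonicity \<xi> \<longleftrightarrow>
    (\<forall>N\<in>player_sets. \<forall>C T. C \<subseteq> T \<and> T \<subseteq> N \<longrightarrow> (\<forall>v\<in>games N. \<forall>w\<in>games N.
      (\<forall>S. S \<subseteq> N \<and> S \<noteq> T \<longrightarrow> v S = w S) \<and> v T < w T \<longrightarrow> \<xi> C N v \<le> \<xi> C N w))"

definition G_strong_monotonicity :: "group_val \<Rightarrow> bool" where
  "G_strong_monotonicity \<xi> \<longleftrightarrow>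
    (\<forall>N\<in>player_sets. \<forall>C. C \<subseteq> N \<longrightarrow> (\<forall>v\<in>games N. \<forall>w\<in>games N.
      (\<forall>S. S \<subseteq> N - C \<longrightarrow> v (S \<union> C) - v S \<le> w (S \<union> C) - w S) \<longrightarrow> \<xi> C N v \<le> \<xi> C N w))"

definition G_positivity :: "group_val \<Rightarrow> bool" where
  "G_positivity \<xi> \<longleftrightarrow>
    (\<forall>N\<in>player_sets. \<forall>C. C \<subseteq> N \<longrightarrow> (\<forall>v\<in>games N. monotonic N v \<longrightarrow> \<xi> C N v \<ge> 0))"

definition G_relative_invariance_strategic_equivalence :: "group_val \<Rightarrow> bool" where
  "G_relative_invariance_strategic_equivalence \<xi> \<longleftrightarrow>
    (\<forall>N\<in>player_sets. \<forall>C. C \<subseteq> N \<longrightarrow> (\<forall>v\<in>games N. \<forall>a b. a > 0 \<longrightarrow>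
      \<xi> C N (\<lambda>S\<in>Pow N. a * v S + (\<Sum>i\<in>S. b i)) = a * \<xi> C N v + (\<Sum>i\<in>C. b i)))"

definition G_coalitional_strategic_equivalence :: "group_val \<Rightarrow> bool" where
  "G_coalitional_strategic_equivalence \<xi> \<longleftrightarrow>
    (\<forall>N\<in>player_sets. \<forall>C T. C \<subset> N \<and> T \<noteq> {} \<and> T \<subseteq> N - C \<longrightarrow> (\<forall>r. \<forall>v\<in>games N.
      \<xi> C N v = \<xi> C N (\<lambda>S\<in>Pow N. v S + r * unanimity_game N T S)))"

definition G_fair_ranking :: "group_val \<Rightarrow> bool" where
  "G_fair_ranking \<xi> \<longleftrightarrow>
    (\<forall>N\<in>player_sets. \<forall>T. T \<subseteq> N \<longrightarrow> (\<forall>v\<in>games N. \<forall>w\<in>games N.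
      (\<forall>S. S \<subseteq> N \<and> S \<noteq> T \<longrightarrow> v S = w S) \<longrightarrow>
      (\<forall>C1 C2. C1 \<subseteq> T \<and> C2 \<subseteq> T \<and> card C1 = card C2 \<longrightarrow>
        \<xi> C1 N v > \<xi> C2 N v \<longrightarrow> \<xi> C1 N w > \<xi> C2 N w)))"

section \<open>Consistency of the definitions\<close>

lemma permuted_game_apply:
  assumes "\<pi> permutes N" "S \<subseteq> N"
  shows "permuted_game \<pi> N v (\<pi> ` S) = v S"
proof -
  have "inv \<pi> ` \<pi> ` S = S"
    using permutes_inj[OF assms(1)] by (simp add: image_comp)
  then show ?thesis
    using assms(2) by (simp add: permuted_game_def image_mono)
qed

lemma permuted_game_in_games: "v \<in> games N \<Longrightarrow> permuted_game \<pi> N v \<in> games (\<pi> ` N)"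
  by (simp add: games_def permuted_game_def)

lemma subgame_in_games: "v \<in> games N \<Longrightarrow> subgame M v \<in> games M"
  by (simp add: games_def subgame_def)

lemma unanimity_game_in_games: "S \<noteq> {} \<Longrightarrow> unanimity_game N S \<in> games N"
  by (simp add: games_def unanimity_game_def)

lemma merging_game_in_games:
  "v \<in> games N \<Longrightarrow> merging_game N v C \<in> games (merged_players N C)"
  by (simp add: games_def merging_game_def)

lemma card_merged_players:
  assumes "finite N" "C \<subseteq> N"
  shows "card (merged_players N C) = card N - card C + 1"
  using assms by (simp add: merged_players_def card_image card_Diff_subset finite_subset)

lemma group_value_shapley: "group_value shapley_group_value"
  by (simp add: group_value_def shapley_group_value_def)

end

theory Submission
  imports Defs
begin

text \<open>
  Line up the members of \<open>N - C\<close> and one proxy for \<open>C\<close> in a uniformly random order, and let \<open>S\<close> be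
  the set of players in front of the proxy. The Shapley group value of \<open>C\<close> is the mean of the
  marginal contribution \<open>v (S \<union> C) - v S\<close>. Below, \<open>predecessor_mean R f\<close> is the mean of \<open>f S\<close> when
  \<open>S\<close> is the random set of predecessors of a proxy lined up with the members of \<open>R\<close>, and
  \<open>shapley_group_value_eq_mean\<close> is the resulting formula for the group value. As it gives \<open>0\<close> for
  \<open>C = {}\<close>, the empty group rarely has to be treated separately.

  A mean is linear, monotone and invariant under bijections, and it fixes constants. Linearity,
  strong monotonicity, positivity, anonymity and both kinds of strategic equivalence follow from
  this, because the line-ups to be compared have the same players up to renaming.

  The dummy player property, its special case for null players, and balanced contributions compare
  line-ups with different players. Deleting a player from a random line-up leaves a random line-up
  of the others. For the probabilities this is the Pascal-type identity \<open>predecessor_prob_Suc\<close>. Consequently a dummy player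
  can be deleted (\<open>predecessor_mean_insert_irrelevant\<close>), and in the balanced contributions equation
  all means that do not cancel can be written as sums over the subsets of \<open>N - C - {i, j}\<close>, where the
  two sides agree termwise.

  Coalitional monotonicity, fair ranking and the value of \<open>u\<^sub>N\<close> concern a change of the worth of a
  single coalition \<open>T \<supseteq> C\<close>. If \<open>C \<noteq> {}\<close>, then \<open>v T\<close> enters the mean only through \<open>S = T - C\<close>, with
  a positive factor that depends only on the sizes of \<open>N\<close>, \<open>C\<close> and \<open>T\<close>
  (\<open>shapley_group_value_change_one\<close>).

  Coherence is the efficiency of the Shapley value: in the sum over all players, the coefficients of
  every coalition other than \<open>{}\<close> and \<open>N\<close> cancel.
\<close>

section \<open>The mean over random sets of predecessors\<close>

text \<open>The probability that the predecessors of the proxy are one particular set of \<open>s\<close> of the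
  \<open>r\<close> other players.\<close>
definition predecessor_prob :: "nat \<Rightarrow> nat \<Rightarrow> real" where
  "predecessor_prob r s = fact s * fact (r - s) / fact (Suc r)"

definition predecessor_mean :: "'a set \<Rightarrow> ('a set \<Rightarrow> real) \<Rightarrow> real" where
  "predecessor_mean R f = (\<Sum>S\<in>Pow R. predecessor_prob (card R) (card S) * f S)"

lemma predecessor_prob_pos: "predecessor_prob r s > 0"
  by (simp add: predecessor_prob_def)

text \<open>An additional player stands either behind or in front of the proxy.\<close>
lemma predecessor_prob_Suc:
  assumes "s \<le> r"
  shows "predecessor_prob r s = predecessor_prob (Suc r) s + predecessor_prob (Suc r) (Suc s)"
proof -
  obtain k where r: "r = s + k"
    using assms le_Suc_ex by blast
  have "predecessor_prob (Suc r) s + predecessor_prob (Suc r) (Suc s)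
      = (fact s * (real k + 1) * fact k + (real s + 1) * fact s * fact k) / fact (Suc (Suc r))"
    by (simp add: predecessor_prob_def r Suc_diff_le add_divide_distrib algebra_simps)
  also have "\<dots> = (real r + 2) * (fact s * fact k) / ((real r + 2) * fact (Suc r))"
    by (simp add: r algebra_simps)
  also have "\<dots> = fact s * fact k / fact (Suc r)"
    by (rule mult_divide_mult_cancel_left) simp
  finally show ?thesis
    by (simp add: predecessor_prob_def r)
qed

lemma sum_Pow_insert:
  fixes f :: "'a set \<Rightarrow> real"
  assumes "finite R" "x \<notin> R"
  shows "(\<Sum>S\<in>Pow (insert x R). f S) = (\<Sum>S\<in>Pow R. f S + f (insert x S))"
proof -
  have "inj_on (insert x) (Pow R)"
    using assms(2) by (auto simp: inj_on_def)
  moreover have "Pow R \<inter> insert x ` Pow R = {}"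
    using assms(2) by auto
  ultimately show ?thesis
    using assms(1) by (simp add: Pow_insert sum.union_disjoint sum.reindex sum.distrib)
qed

lemma predecessor_mean_insert:
  assumes "finite R" "x \<notin> R"
  shows "predecessor_mean (insert x R) f =
    (\<Sum>S\<in>Pow R. predecessor_prob (Suc (card R)) (card S) * f S
              + predecessor_prob (Suc (card R)) (Suc (card S)) * f (insert x S))"
proof -
  have "card (insert x S) = Suc (card S)" if "S \<in> Pow R" for S
    using that assms finite_subset by (subst card_insert_disjoint) auto
  then show ?thesis
    using assms by (simp add: predecessor_mean_def sum_Pow_insert)
qed

lemma predecessor_mean_extra_player:
  assumes "finite R"
  shows "predecessor_mean R f =
    (\<Sum>S\<in>Pow R. predecessor_prob (Suc (card R)) (card S) * f S
              + predecessor_prob (Suc (card R)) (Suc (card S)) * f S)"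
  unfolding predecessor_mean_def
proof (rule sum.cong)
  fix S assume "S \<in> Pow R"
  then have "card S \<le> card R"
    using assms by (simp add: card_mono)
  then show "predecessor_prob (card R) (card S) * f S =
      predecessor_prob (Suc (card R)) (card S) * f S
      + predecessor_prob (Suc (card R)) (Suc (card S)) * f S"
    by (simp only: predecessor_prob_Suc[of "card S" "card R"] distrib_right)
qed simp

lemma predecessor_mean_cong:
  "(\<And>S. S \<subseteq> R \<Longrightarrow> f S = g S) \<Longrightarrow> predecessor_mean R f = predecessor_mean R g"
  by (simp add: predecessor_mean_def)

lemma predecessor_mean_insert_irrelevant:
  assumes "finite R" "x \<notin> R" "\<And>S. S \<subseteq> R \<Longrightarrow> f (insert x S) = f S"
  shows "predecessor_mean (insert x R) f = predecessor_mean R f"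
  using assms by (simp add: predecessor_mean_insert predecessor_mean_extra_player[of R])

text \<open>The probabilities sum to \<open>1\<close>, because all players can be deleted one after the other.\<close>
lemma predecessor_mean_const: "finite R \<Longrightarrow> predecessor_mean R (\<lambda>S. k) = k"
proof (induction R rule: finite_induct)
  case empty
  show ?case by (simp add: predecessor_mean_def predecessor_prob_def)
next
  case (insert x R)
  then show ?case by (simp add: predecessor_mean_insert_irrelevant)
qed

lemma predecessor_mean_linear:
  "predecessor_mean R (\<lambda>S. a * f S + b * g S) =
    a * predecessor_mean R f + b * predecessor_mean R g"
  by (simp add: predecessor_mean_def sum.distrib sum_distrib_left algebra_simps)

lemma predecessor_mean_add_const:
  "finite R \<Longrightarrow> predecessor_mean R (\<lambda>S. a * f S + k) = a * predecessor_mean R f + k"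
  using predecessor_mean_linear[of R a f 1 "\<lambda>S. k"] by (simp add: predecessor_mean_const)

lemma predecessor_mean_mono:
  "(\<And>S. S \<subseteq> R \<Longrightarrow> f S \<le> g S) \<Longrightarrow> predecessor_mean R f \<le> predecessor_mean R g"
  unfolding predecessor_mean_def
  by (intro sum_mono mult_left_mono) (auto intro: less_imp_le predecessor_prob_pos)

lemma predecessor_mean_image:
  assumes "inj_on h R"
  shows "predecessor_mean (h ` R) f = predecessor_mean R (\<lambda>S. f (h ` S))"
proof -
  have "card (h ` S) = card S" if "S \<in> Pow R" for S
    using that assms by (auto intro: card_image inj_on_subset)
  moreover have "card (h ` R) = card R"
    using assms by (rule card_image)
  moreover have "Pow (h ` R) = (`) h ` Pow R"
    by (simp add: image_Pow_surj)
  moreover have "inj_on ((`) h) (Pow R)"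
    using assms by (rule inj_on_image_Pow)
  ultimately show ?thesis
    by (simp add: predecessor_mean_def sum.reindex)
qed

section \<open>The Shapley group value as a mean\<close>

lemma shapley_eq_mean:
  assumes "finite N" "i \<in> N"
  shows "shapley N v i = predecessor_mean (N - {i}) (\<lambda>S. v (S \<union> {i}) - v S)"
proof -
  have "card N = Suc (card (N - {i}))"
    using assms by (metis card_Suc_Diff1)
  then show ?thesis
    by (simp add: shapley_def predecessor_mean_def predecessor_prob_def)
qed

theorem shapley_group_value_eq_mean:
  assumes "finite N" "C \<subseteq> N"
  shows "shapley_group_value C N v = predecessor_mean (N - C) (\<lambda>S. v (S \<union> C) - v S)"
proof (cases "C = {}")
  case True
  then show ?thesis by (simp add: shapley_group_value_def predecessor_mean_def)
next
  case False
  let ?M = "merged_players N C" and ?u = "merging_game N v C"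
  have "shapley_group_value C N v = shapley ?M ?u None"
    using False by (simp add: shapley_group_value_def)
  also have "\<dots> = predecessor_mean (?M - {None}) (\<lambda>S. ?u (S \<union> {None}) - ?u S)"
    using assms(1) by (intro shapley_eq_mean) (auto simp: merged_players_def)
  also have "?M - {None} = Some ` (N - C)"
    by (auto simp: merged_players_def)
  also have "predecessor_mean \<dots> (\<lambda>S. ?u (S \<union> {None}) - ?u S) =
      predecessor_mean (N - C) (\<lambda>S. ?u (Some ` S \<union> {None}) - ?u (Some ` S))"
    by (rule predecessor_mean_image) simp
  also have "\<dots> = predecessor_mean (N - C) (\<lambda>S. v (S \<union> C) - v S)"
  proof (rule predecessor_mean_cong)
    fix S assume "S \<subseteq> N - C"
    then have "Some ` S \<union> {None} \<in> Pow ?M" "Some ` S \<in> Pow ?M"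
      by (auto simp: merged_players_def)
    moreover have "Some -` (Some ` S \<union> {None}) = S" "Some -` Some ` S = S"
      by auto
    ultimately show "?u (Some ` S \<union> {None}) - ?u (Some ` S) = v (S \<union> C) - v S"
      by (auto simp: merging_game_def)
  qed
  finally show ?thesis .
qed

lemma player_sets_finite: "N \<in> player_sets \<Longrightarrow> finite N"
  by (simp add: player_sets_def)

section \<open>Line-ups with the same players\<close>

lemma shapley_group_value_linear: "G_linearity shapley_group_value"
  unfolding G_linearity_def
proof (intro ballI allI impI)
  fix N C a1 a2 and v w :: "nat set \<Rightarrow> real"
  assume N: "N \<in> player_sets" and C: "C \<subseteq> N"
  let ?u = "\<lambda>S\<in>Pow N. a1 * v S + a2 * w S"
  have "predecessor_mean (N - C) (\<lambda>S. ?u (S \<union> C) - ?u S) =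
      predecessor_mean (N - C) (\<lambda>S. a1 * (v (S \<union> C) - v S) + a2 * (w (S \<union> C) - w S))"
  proof (rule predecessor_mean_cong)
    fix S assume "S \<subseteq> N - C"
    then have "S \<subseteq> N" "S \<union> C \<subseteq> N"
      using C by auto
    then show "?u (S \<union> C) - ?u S = a1 * (v (S \<union> C) - v S) + a2 * (w (S \<union> C) - w S)"
      by (simp add: algebra_simps)
  qed
  then show "shapley_group_value C N ?u =
      a1 * shapley_group_value C N v + a2 * shapley_group_value C N w"
    using player_sets_finite[OF N] C
    by (simp add: shapley_group_value_eq_mean predecessor_mean_linear)
qed

lemma shapley_group_value_strongly_monotonic: "G_strong_monotonicity shapley_group_value"
  unfolding G_strong_monotonicity_def
  by (auto simp: shapley_group_value_eq_mean player_sets_finite intro: predecessor_mean_mono)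

lemma shapley_group_value_positive: "G_positivity shapley_group_value"
  unfolding G_positivity_def
proof (intro ballI allI impI)
  fix N C and v :: "nat set \<Rightarrow> real"
  assume N: "N \<in> player_sets" and C: "C \<subseteq> N" and v: "monotonic N v"
  have "0 = predecessor_mean (N - C) (\<lambda>S. 0)"
    using player_sets_finite[OF N] by (simp add: predecessor_mean_const)
  also have "\<dots> \<le> predecessor_mean (N - C) (\<lambda>S. v (S \<union> C) - v S)"
  proof (rule predecessor_mean_mono)
    fix S assume "S \<subseteq> N - C"
    then have "S \<subseteq> S \<union> C" "S \<union> C \<subseteq> N"
      using C by auto
    then show "0 \<le> v (S \<union> C) - v S"
      using v unfolding monotonic_def by (meson diff_ge_0_iff_ge)
  qed
  finally show "shapley_group_value C N v \<ge> 0"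
    using player_sets_finite[OF N] C by (simp add: shapley_group_value_eq_mean)
qed

lemma shapley_group_value_relatively_invariant:
  "G_relative_invariance_strategic_equivalence shapley_group_value"
  unfolding G_relative_invariance_strategic_equivalence_def
proof (intro ballI allI impI)
  fix N C a b and v :: "nat set \<Rightarrow> real"
  assume N: "N \<in> player_sets" and C: "C \<subseteq> N"
  note fin = player_sets_finite[OF N]
  let ?w = "\<lambda>S\<in>Pow N. a * v S + (\<Sum>i\<in>S. b i)"
  have "predecessor_mean (N - C) (\<lambda>S. ?w (S \<union> C) - ?w S) =
      predecessor_mean (N - C) (\<lambda>S. a * (v (S \<union> C) - v S) + (\<Sum>i\<in>C. b i))"
  proof (rule predecessor_mean_cong)
    fix S assume S: "S \<subseteq> N - C"
    then have "S \<subseteq> N" "S \<union> C \<subseteq> N"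
      using C by auto
    moreover have "(\<Sum>i\<in>S \<union> C. b i) = (\<Sum>i\<in>S. b i) + (\<Sum>i\<in>C. b i)"
      using S C fin by (intro sum.union_disjoint) (auto intro: finite_subset)
    ultimately show "?w (S \<union> C) - ?w S = a * (v (S \<union> C) - v S) + (\<Sum>i\<in>C. b i)"
      by (simp add: algebra_simps)
  qed
  then show "shapley_group_value C N ?w = a * shapley_group_value C N v + (\<Sum>i\<in>C. b i)"
    using fin C by (simp add: shapley_group_value_eq_mean predecessor_mean_add_const)
qed

text \<open>Whether \<open>T\<close> is contained in a coalition does not depend on the members of a group disjoint
  from \<open>T\<close>, so \<open>u\<^sub>T\<close> does not change the marginal contributions of such a group.\<close>
lemma shapley_group_value_strategically_equivalent:
  "G_coalitional_strategic_equivalence shapley_group_value"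
  unfolding G_coalitional_strategic_equivalence_def
proof (intro ballI allI impI)
  fix N C T r and v :: "nat set \<Rightarrow> real"
  assume N: "N \<in> player_sets" and CT: "C \<subset> N \<and> T \<noteq> {} \<and> T \<subseteq> N - C"
  let ?w = "\<lambda>S\<in>Pow N. v S + r * unanimity_game N T S"
  have "predecessor_mean (N - C) (\<lambda>S. v (S \<union> C) - v S) =
      predecessor_mean (N - C) (\<lambda>S. ?w (S \<union> C) - ?w S)"
  proof (rule predecessor_mean_cong)
    fix S assume "S \<subseteq> N - C"
    then have "S \<subseteq> N" "S \<union> C \<subseteq> N"
      using CT by auto
    moreover have "T \<subseteq> S \<union> C \<longleftrightarrow> T \<subseteq> S"
      using CT by auto
    ultimately show "v (S \<union> C) - v S = ?w (S \<union> C) - ?w S"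
      by (simp add: unanimity_game_def)
  qed
  then show "shapley_group_value C N v = shapley_group_value C N ?w"
    using player_sets_finite[OF N] CT by (simp add: shapley_group_value_eq_mean psubset_imp_subset)
qed

lemma shapley_group_value_anonymous: "G_anonymity shapley_group_value"
  unfolding G_anonymity_def
proof (intro ballI allI impI)
  fix N C \<pi> and v :: "nat set \<Rightarrow> real"
  assume N: "N \<in> player_sets" and C: "C \<subseteq> N" and \<pi>: "\<pi> permutes N"
  note fin = player_sets_finite[OF N]
  let ?w = "permuted_game \<pi> N v"
  have inj: "inj \<pi>"
    using \<pi> by (rule permutes_inj)
  have "shapley_group_value (\<pi> ` C) (\<pi> ` N) ?w =
      predecessor_mean (\<pi> ` (N - C)) (\<lambda>S. ?w (S \<union> \<pi> ` C) - ?w S)"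
    using fin C by (simp add: shapley_group_value_eq_mean image_mono image_set_diff[OF inj])
  also have "\<dots> = predecessor_mean (N - C) (\<lambda>S. ?w (\<pi> ` (S \<union> C)) - ?w (\<pi> ` S))"
    using inj by (simp add: predecessor_mean_image inj_on_subset image_Un)
  also have "\<dots> = predecessor_mean (N - C) (\<lambda>S. v (S \<union> C) - v S)"
  proof (rule predecessor_mean_cong)
    fix S assume "S \<subseteq> N - C"
    then have "S \<subseteq> N" "S \<union> C \<subseteq> N"
      using C by auto
    then show "?w (\<pi> ` (S \<union> C)) - ?w (\<pi> ` S) = v (S \<union> C) - v S"
      using \<pi> by (simp only: permuted_game_apply)
  qed
  also have "\<dots> = shapley_group_value C N v"
    using fin C by (simp add: shapley_group_value_eq_mean)
  finally show "shapley_group_value (\<pi> ` C) (\<pi> ` N) ?w = shapley_group_value C N v" .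
qed

section \<open>Deleting players from a line-up\<close>

text \<open>The marginal contributions of \<open>C\<close> are the same with and without the dummy player in front, so
  the value of \<open>C\<close> is a mean over the line-ups without the dummy player. These are the line-ups for
  \<open>C \<union> {i}\<close>, whose marginal contributions are larger by \<open>v {i}\<close>.\<close>
lemma shapley_group_value_dummy_player: "G_dummy_player shapley_group_value"
  unfolding G_dummy_player_def
proof (intro ballI allI impI)
  fix N C i and v :: "nat set \<Rightarrow> real"
  assume N: "N \<in> player_sets" and C: "C \<subset> N" and i: "i \<in> N - C" and dummy: "dummy_player N v i"
  note fin = player_sets_finite[OF N]
  define R where "R = N - (C \<union> {i})"
  have R: "N - C = insert i R" "finite R" "i \<notin> R"
    using i fin by (auto simp: R_def)
  have v: "v (insert i S) = v S + v {i}" if "S \<subseteq> N - {i}" for S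
    using dummy that unfolding dummy_player_def by (metis Un_insert_right sup_bot.right_neutral)
  have v1: "v (insert i S) = v S + v {i}" "v (insert i (S \<union> C)) = v (S \<union> C) + v {i}"
    if "S \<subseteq> R" for S
    using that C i by (auto simp: R_def intro!: v)
  have "shapley_group_value C N v = predecessor_mean (insert i R) (\<lambda>S. v (S \<union> C) - v S)"
    using fin C R(1) by (simp add: shapley_group_value_eq_mean)
  also have "\<dots> = predecessor_mean R (\<lambda>S. v (S \<union> C) - v S)"
    using R(2,3)
  proof (rule predecessor_mean_insert_irrelevant)
    fix S assume "S \<subseteq> R"
    then show "v (insert i S \<union> C) - v (insert i S) = v (S \<union> C) - v S"
      using v1[of S] by simp
  qed
  finally have C_value: "shapley_group_value C N v = \<dots>" .
  have "shapley_group_value (C \<union> {i}) N v = predecessor_mean R (\<lambda>S. v (S \<union> (C \<union> {i})) - v S)"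
    unfolding R_def using fin C i by (intro shapley_group_value_eq_mean) auto
  also have "\<dots> = predecessor_mean R (\<lambda>S. 1 * (v (S \<union> C) - v S) + v {i})"
    by (rule predecessor_mean_cong) (use v1(2) in simp)
  also have "\<dots> = shapley_group_value C N v + v {i}"
    by (subst predecessor_mean_add_const[OF R(2)]) (simp add: C_value)
  finally show "shapley_group_value (C \<union> {i}) N v = shapley_group_value C N v + v {i}" .
qed

lemma shapley_group_value_null_player: "G_null_player shapley_group_value"
  using shapley_group_value_dummy_player
  by (simp add: G_dummy_player_def G_null_player_def null_player_def)

text \<open>The value of \<open>C\<close> in \<open>N\<close> occurs on both sides and cancels. With \<open>R = N - C - {i, j}\<close>, all
  other values are sums over \<open>S \<subseteq> R\<close> of terms with the two probabilities for a line-up of the proxy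
  with \<open>|R| + 1\<close> players. In the three sums that remain on the left, \<open>v (S \<union> C \<union> {i})\<close> has the total
  coefficient \<open>0\<close>, and what is left over is symmetric in \<open>i\<close> and \<open>j\<close>.\<close>
lemma shapley_group_value_balanced_contributions:
  "G_coalitional_balanced_contributions shapley_group_value"
  unfolding G_coalitional_balanced_contributions_def
proof (intro ballI allI impI)
  fix N C i j and v :: "nat set \<Rightarrow> real"
  assume N: "N \<in> player_sets" and C: "C \<subset> N" and i: "i \<in> N - C" and j: "j \<in> N - C"
    and "i \<noteq> j"
  note fin = player_sets_finite[OF N]
  define R where "R = N - C - {i, j}"
  have R: "finite R" "i \<notin> R" "j \<notin> R"
    using fin by (auto simp: R_def)
  define p where "p = predecessor_prob (Suc (card R))"
  let ?\<phi> = "shapley_group_value"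
  have value_sums:
    "?\<phi> (C \<union> {x}) N v =
      (\<Sum>S\<in>Pow R. p (card S) * (v (S \<union> (C \<union> {x})) - v S)
        + p (Suc (card S)) * (v (insert y S \<union> (C \<union> {x})) - v (insert y S)))" (is ?joined)
    "?\<phi> (C \<union> {x}) (N - {y}) (subgame (N - {y}) v) =
      (\<Sum>S\<in>Pow R. p (card S) * (v (S \<union> (C \<union> {x})) - v S)
        + p (Suc (card S)) * (v (S \<union> (C \<union> {x})) - v S))" (is ?joined_subgame)
    "?\<phi> C (N - {y}) (subgame (N - {y}) v) =
      (\<Sum>S\<in>Pow R. p (card S) * (v (S \<union> C) - v S)
        + p (Suc (card S)) * (v (insert x S \<union> C) - v (insert x S)))" (is ?subgame)
    if "x \<noteq> y" "{x, y} = {i, j}" for x y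
  proof -
    have xy: "x \<in> N - C" "y \<in> N - C" "x \<notin> R" "y \<notin> R" and R': "R = N - C - {x, y}"
      using that i j R by (auto simp: R_def doubleton_eq_iff)
    have sub: "?\<phi> D (N - {y}) (subgame (N - {y}) v) =
        predecessor_mean (N - {y} - D) (\<lambda>S. v (S \<union> D) - v S)" if "D \<subseteq> N - {y}" for D
    proof -
      have "?\<phi> D (N - {y}) (subgame (N - {y}) v) = predecessor_mean (N - {y} - D)
          (\<lambda>S. subgame (N - {y}) v (S \<union> D) - subgame (N - {y}) v S)"
        using fin that by (intro shapley_group_value_eq_mean) auto
      also have "\<dots> = predecessor_mean (N - {y} - D) (\<lambda>S. v (S \<union> D) - v S)"
      proof (rule predecessor_mean_cong)
        fix S assume "S \<subseteq> N - {y} - D"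
        then have "S \<subseteq> N - {y}" "S \<union> D \<subseteq> N - {y}"
          using that by auto
        then show "subgame (N - {y}) v (S \<union> D) - subgame (N - {y}) v S = v (S \<union> D) - v S"
          by (simp add: subgame_def)
      qed
      finally show ?thesis .
    qed
    have eqs: "N - (C \<union> {x}) = insert y R" "N - {y} - (C \<union> {x}) = R" "N - {y} - C = insert x R"
      using xy \<open>x \<noteq> y\<close> by (auto simp: R')
    have "?\<phi> (C \<union> {x}) N v =
        predecessor_mean (insert y R) (\<lambda>S. v (S \<union> (C \<union> {x})) - v S)"
      unfolding eqs(1)[symmetric] using fin C xy by (intro shapley_group_value_eq_mean) auto
    then show ?joined
      using R(1) xy unfolding p_def by (simp only: predecessor_mean_insert not_False_eq_True)
    have "C \<union> {x} \<subseteq> N - {y}" "C \<subseteq> N - {y}"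
      using C xy \<open>x \<noteq> y\<close> by auto
    note subs = this[THEN sub, unfolded eqs]
    show ?joined_subgame
      unfolding subs(1) p_def using R(1) by (rule predecessor_mean_extra_player)
    show ?subgame
      unfolding subs(2) p_def using R(1) xy(3) by (rule predecessor_mean_insert)
  qed
  have sets: "insert j S \<union> (C \<union> {i}) = insert i S \<union> (C \<union> {j})"
    "S \<union> (C \<union> {i}) = insert i S \<union> C" "S \<union> (C \<union> {j}) = insert j S \<union> C" for S
    by auto
  have "{j, i} = {i, j}"
    by auto
  note value_sums_ij = value_sums[OF \<open>i \<noteq> j\<close> refl]
    and value_sums_ji = value_sums[OF \<open>i \<noteq> j\<close>[symmetric] this]
  have "?\<phi> (C \<union> {i}) N v - ?\<phi> (C \<union> {i}) (N - {j}) (subgame (N - {j}) v)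
        + ?\<phi> C (N - {j}) (subgame (N - {j}) v)
      = ?\<phi> (C \<union> {j}) N v - ?\<phi> (C \<union> {j}) (N - {i}) (subgame (N - {i}) v)
        + ?\<phi> C (N - {i}) (subgame (N - {i}) v)"
    unfolding value_sums_ij value_sums_ji sum_subtractf[symmetric] sum.distrib[symmetric] sets
    by (rule sum.cong) (auto simp: algebra_simps insert_commute)
  then show "(?\<phi> (C \<union> {i}) N v - ?\<phi> C N v)
      - (?\<phi> (C \<union> {i}) (N - {j}) (subgame (N - {j}) v) - ?\<phi> C (N - {j}) (subgame (N - {j}) v))
    = (?\<phi> (C \<union> {j}) N v - ?\<phi> C N v)
      - (?\<phi> (C \<union> {j}) (N - {i}) (subgame (N - {i}) v) - ?\<phi> C (N - {i}) (subgame (N - {i}) v))"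
    by linarith
qed

section \<open>Changing the worth of a single coalition\<close>

text \<open>As \<open>C\<close> is non-empty, \<open>T\<close> is not a set of predecessors of \<open>C\<close>. So \<open>v T\<close> enters only as the
  worth of \<open>S \<union> C\<close> for \<open>S = T - C\<close>.\<close>
lemma shapley_group_value_change_one:
  assumes "finite N" "C \<noteq> {}" "C \<subseteq> T" "T \<subseteq> N"
    and eq: "\<And>S. S \<subseteq> N \<Longrightarrow> S \<noteq> T \<Longrightarrow> v S = w S"
  shows "shapley_group_value C N w = shapley_group_value C N v
    + predecessor_prob (card N - card C) (card T - card C) * (w T - v T)"
proof -
  let ?p = "\<lambda>S. predecessor_prob (card (N - C)) (card S)"
  have fin: "finite C" "finite (N - C)"
    using assms(1,3,4) by (meson finite_Diff finite_subset)+
  have "shapley_group_value C N w =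
      (\<Sum>S\<in>Pow (N - C). ?p S * (v (S \<union> C) - v S) + (if S = T - C then ?p S * (w T - v T) else 0))"
    unfolding shapley_group_value_eq_mean[OF assms(1) subset_trans[OF assms(3,4)]]
      predecessor_mean_def
  proof (rule sum.cong)
    fix S assume "S \<in> Pow (N - C)"
    then have S: "S \<subseteq> N" "S \<union> C \<subseteq> N" "S \<inter> C = {}"
      using assms(3,4) by auto
    then have "S \<noteq> T"
      using assms(2,3) by auto
    then have "w S = v S"
      using S eq by simp
    moreover have "S \<union> C = T \<longleftrightarrow> S = T - C"
      using S assms(3) by auto
    moreover have "w (S \<union> C) = v (S \<union> C)" if "S \<union> C \<noteq> T"
      using S eq that by simp
    ultimately show "?p S * (w (S \<union> C) - w S) =
        ?p S * (v (S \<union> C) - v S) + (if S = T - C then ?p S * (w T - v T) else 0)"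
      by (cases "S \<union> C = T") (simp_all add: algebra_simps)
  qed simp
  also have "\<dots> = shapley_group_value C N v + ?p (T - C) * (w T - v T)"
    using assms fin
    by (simp add: sum.distrib shapley_group_value_eq_mean predecessor_mean_def Diff_mono)
  finally show ?thesis
    using assms fin by (simp add: card_Diff_subset)
qed

lemma shapley_group_value_coalitionally_monotonic:
  "G_coalitional_monotonicity shapley_group_value"
  unfolding G_coalitional_monotonicity_def
proof (intro ballI allI impI)
  fix N C T and v w :: "nat set \<Rightarrow> real"
  assume N: "N \<in> player_sets" and CT: "C \<subseteq> T \<and> T \<subseteq> N"
    and vw: "(\<forall>S. S \<subseteq> N \<and> S \<noteq> T \<longrightarrow> v S = w S) \<and> v T < w T"
  show "shapley_group_value C N v \<le> shapley_group_value C N w"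
  proof (cases "C = {}")
    case True
    then show ?thesis by (simp add: shapley_group_value_def)
  next
    case False
    have "shapley_group_value C N w = shapley_group_value C N v
        + predecessor_prob (card N - card C) (card T - card C) * (w T - v T)"
      using player_sets_finite[OF N] False CT vw
      by (intro shapley_group_value_change_one) auto
    then show ?thesis
      using vw predecessor_prob_pos by (simp add: less_imp_le)
  qed
qed

lemma shapley_group_value_fair_ranking: "G_fair_ranking shapley_group_value"
  unfolding G_fair_ranking_def
proof (intro ballI allI impI)
  fix N T C1 C2 and v w :: "nat set \<Rightarrow> real"
  assume N: "N \<in> player_sets" and T: "T \<subseteq> N"
    and vw: "\<forall>S. S \<subseteq> N \<and> S \<noteq> T \<longrightarrow> v S = w S"
    and C: "C1 \<subseteq> T \<and> C2 \<subseteq> T \<and> card C1 = card C2"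
    and less: "shapley_group_value C1 N v > shapley_group_value C2 N v"
  note fin = player_sets_finite[OF N]
  have "finite C1" "finite C2"
    using C T fin by (auto intro: finite_subset)
  then have "C1 = {} \<longleftrightarrow> C2 = {}"
    using C by (metis card_0_eq)
  then have ne: "C1 \<noteq> {}" "C2 \<noteq> {}"
    using less by (auto simp: shapley_group_value_def)
  have change: "shapley_group_value D N w = shapley_group_value D N v
      + predecessor_prob (card N - card D) (card T - card D) * (w T - v T)"
    if "D \<noteq> {}" "D \<subseteq> T" for D
    using fin that T vw by (intro shapley_group_value_change_one) auto
  show "shapley_group_value C1 N w > shapley_group_value C2 N w"
    using less C ne by (simp add: change)
qed

text \<open>The game \<open>u\<^sub>N\<close> differs from the zero game only in the worth of \<open>N\<close>.\<close>
lemma shapley_group_value_pure_bargaining: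
  "G_symmetry_pure_bargaining shapley_group_value"
  unfolding G_symmetry_pure_bargaining_def
proof (intro ballI allI impI)
  fix N C :: "nat set"
  assume N: "N \<in> player_sets" and C: "C \<noteq> {} \<and> C \<subseteq> N"
  note fin = player_sets_finite[OF N]
  have "card C \<le> card N"
    using fin C card_mono by blast
  have "shapley_group_value C N (unanimity_game N N) = shapley_group_value C N (\<lambda>S. 0)
      + predecessor_prob (card N - card C) (card N - card C) * (unanimity_game N N N - 0)"
    using fin C
    by (intro shapley_group_value_change_one) (auto simp: unanimity_game_def)
  also have "shapley_group_value C N (\<lambda>S. 0) = 0"
    using fin C by (simp add: shapley_group_value_eq_mean predecessor_mean_const)
  also have "unanimity_game N N N = 1"
    by (simp add: unanimity_game_def)
  finally show "shapley_group_value C N (unanimity_game N N) =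
      1 / (real (card N) - real (card C) + 1)"
    using \<open>card C \<le> card N\<close>
    by (simp add: predecessor_prob_def of_nat_diff add.commute)
qed

section \<open>Efficiency\<close>

text \<open>The coalition \<open>T\<close> is of the form \<open>S \<union> {i}\<close> for its \<open>|T|\<close> members \<open>i\<close>, and is a set of
  predecessors for the \<open>|N| - |T|\<close> other players. Both numbers, times the respective probability,
  give \<open>|T|! (|N| - |T|)! / |N|!\<close>, except that the first is \<open>0\<close> for \<open>T = {}\<close> and the second for
  \<open>T = N\<close>.\<close>
lemma sum_predecessor_means_eq_grand_coalition:
  assumes "finite N"
  shows "(\<Sum>i\<in>N. predecessor_mean (N - {i}) (\<lambda>S. v (S \<union> {i}) - v S)) = v N - v {}"
proof -
  define n where "n = card N"
  define g :: "'a set \<Rightarrow> real" where "g T = fact (card T) * fact (n - card T) / fact n" for T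
  let ?p = "predecessor_prob (n - 1)"
  have card_le: "card T \<le> n" if "T \<subseteq> N" for T
    using that assms by (simp add: n_def card_mono)
  have mean: "predecessor_mean (N - {i}) (\<lambda>S. v (S \<union> {i}) - v S) =
      (\<Sum>T\<in>Pow N. (if i \<in> T then ?p (card T - 1) * v T else 0)
        - (if i \<in> T then 0 else ?p (card T) * v T))" if "i \<in> N" for i
  proof -
    have N: "N = insert i (N - {i})" and card: "card (N - {i}) = n - 1"
      using that assms by (auto simp: n_def)
    have "card (insert i S) - 1 = card S" if "S \<subseteq> N - {i}" for S
    proof -
      have "finite S" "i \<notin> S"
        using that assms by (auto intro: finite_subset)
      then show ?thesis by simp
    qed
    moreover have "i \<notin> S" if "S \<subseteq> N - {i}" for S
      using that by auto
    ultimately show ?thesis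
      using assms
      by (subst (2) N, subst sum_Pow_insert)
         (auto simp: predecessor_mean_def card algebra_simps intro!: sum.cong)
  qed
  have coeff: "(\<Sum>i\<in>N. (if i \<in> T then ?p (card T - 1) * v T else 0)
        - (if i \<in> T then 0 else ?p (card T) * v T)) =
      (if T = {} then 0 else g T * v T) - (if T = N then 0 else g T * v T)"
    if "T \<subseteq> N" for T
  proof -
    have "finite T"
      using that assms finite_subset by auto
    have members: "real (card T) * ?p (card T - 1) = g T" if "T \<noteq> {}"
    proof -
      obtain k where k: "card T = Suc k"
        using \<open>T \<noteq> {}\<close> \<open>finite T\<close> by (metis card_0_eq not0_implies_Suc)
      then obtain m where "n = Suc m"
        using card_le[OF \<open>T \<subseteq> N\<close>] by (metis Suc_le_D)
      with k show ?thesis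
        by (simp add: g_def predecessor_prob_def)
    qed
    have others: "(real n - real (card T)) * ?p (card T) = g T" if "T \<noteq> N"
    proof -
      have "card T < n"
        using that \<open>T \<subseteq> N\<close> assms by (simp add: n_def psubset_card_mono psubsetI)
      then obtain d where d: "n = Suc (card T + d)"
        using less_imp_Suc_add by blast
      then show ?thesis
        by (simp add: g_def predecessor_prob_def Suc_diff_le algebra_simps)
    qed
    have "N \<inter> {i. i \<in> T} = T" "N \<inter> - {i. i \<in> T} = N - T"
      using that by auto
    moreover have "real (card (N - T)) = real n - real (card T)"
      using that \<open>finite T\<close> card_le[OF that] by (simp add: n_def card_Diff_subset of_nat_diff)
    ultimately have "(\<Sum>i\<in>N. (if i \<in> T then ?p (card T - 1) * v T else 0)
        - (if i \<in> T then 0 else ?p (card T) * v T)) =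
      real (card T) * ?p (card T - 1) * v T - (real n - real (card T)) * ?p (card T) * v T"
      using assms by (simp add: sum_subtractf sum.If_cases)
    then show ?thesis
      using members others by (auto simp: n_def)
  qed
  have "(\<Sum>i\<in>N. predecessor_mean (N - {i}) (\<lambda>S. v (S \<union> {i}) - v S)) =
      (\<Sum>T\<in>Pow N. \<Sum>i\<in>N. (if i \<in> T then ?p (card T - 1) * v T else 0)
        - (if i \<in> T then 0 else ?p (card T) * v T))"
    by (subst sum.swap) (rule sum.cong[OF refl mean])
  also have "\<dots> = (\<Sum>T\<in>Pow N. (if T = N then g T * v T else 0) - (if T = {} then g T * v T else 0))"
    by (rule sum.cong) (simp_all only: coeff Pow_iff, auto)
  also have "\<dots> = g N * v N - g {} * v {}"
    using assms by (simp add: sum_subtractf)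
  also have "\<dots> = v N - v {}"
    by (simp add: g_def n_def)
  finally show ?thesis .
qed

lemma shapley_group_value_coherent: "G_coherence shapley_group_value"
  unfolding G_coherence_def
proof (intro ballI)
  fix N and v :: "nat set \<Rightarrow> real"
  assume N: "N \<in> player_sets"
  note fin = player_sets_finite[OF N]
  have "(\<Sum>i\<in>N. shapley_group_value {i} N v) =
      (\<Sum>i\<in>N. predecessor_mean (N - {i}) (\<lambda>S. v (S \<union> {i}) - v S))"
    by (rule sum.cong) (use fin in \<open>auto simp: shapley_group_value_eq_mean\<close>)
  also have "\<dots> = v N - v {}"
    using fin by (rule sum_predecessor_means_eq_grand_coalition)
  also have "\<dots> = shapley_group_value N N v"
    using fin by (simp add: shapley_group_value_eq_mean predecessor_mean_def predecessor_prob_def)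
  finally show "(\<Sum>i\<in>N. shapley_group_value {i} N v) = shapley_group_value N N v" .
qed

section \<open>All properties together\<close>

theorem theorem1:
  "G_coherence shapley_group_value
   \<and> G_dummy_player shapley_group_value
   \<and> G_null_player shapley_group_value
   \<and> G_anonymity shapley_group_value
   \<and> G_linearity shapley_group_value
   \<and> G_coalitional_balanced_contributions shapley_group_value
   \<and> G_symmetry_pure_bargaining shapley_group_value
   \<and> G_coalitional_monotonicity shapley_group_value
   \<and> G_strong_monotonicity shapley_group_value
   \<and> G_positivity shapley_group_value
   \<and> G_relative_invariance_strategic_equivalence shapley_group_value
   \<and> G_coalitional_strategic_equivalence shapley_group_value
   \<and> G_fair_ranking shapley_group_value"
  by (intro conjI shapley_group_value_coherent shapley_group_value_dummy_player
      shapley_group_value_null_player shapley_group_value_anonymous shapley_group_value_linear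
      shapley_group_value_balanced_contributions shapley_group_value_pure_bargaining
      shapley_group_value_coalitionally_monotonic shapley_group_value_strongly_monotonic
      shapley_group_value_positive shapley_group_value_relatively_invariant
      shapley_group_value_strategically_equivalent shapley_group_value_fair_ranking)

end
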